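(* Let $0\le\alpha\le 1$ and $\beta=1-\alpha$. Let $G_1$ be a simple connected $k_1$-regular graph with $n_1$ vertices and $m_1$ edges, and let $G_2$ be any simple connected graph with $n_2$ vertices. Let $G=G_1\lozenge G_2$ be their edge corona. Then for $\nu$ not a pole of $\Gamma_{A_\alpha(G_2)}(\nu-2\alpha)$, $$f_{A_\alpha(G)}(\nu)=\bigl(f_{A_\alpha(G_2)}(\nu-2\alpha)\bigr)^{m_1}\cdot f_{A_\alpha(G_1)}\!\left(\frac{\nu-\alpha k_1n_2+\beta k_1(2\alpha-1)\Gamma_{A_\alpha(G_2)}(\nu-2\alpha)}{1+\beta\,\Gamma_{A_\alpha(G_2)}(\nu-2\alpha)}\right)\cdot\bigl[1+\beta\,\Gamma_{A_\alpha(G_2)}(\nu-2\alpha)\bigr]^{n_1}.$$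
   Context: All graphs are simple, undirected and connected. For a graph $G$ with adjacency matrix $A(G)$ and diagonal degree matrix $D(G)$, and $0\le\alpha\le1$, $A_\alpha(G)=\alpha D(G)+(1-\alpha)A(G)$. For a square matrix $M$, $f_M(\theta)=\det(\theta I-M)$, and for an $n\times n$ matrix $M$ the $M$-coronal is $\Gamma_M(\theta)=\mathbf{j}_n^T(\theta I-M)^{-1}\mathbf{j}_n$, with $\mathbf{j}_n$ the all-ones vector. The edge corona $G_1\lozenge G_2$ is obtained by taking one copy of $G_1$ and $m_1$ copies of $G_2$ (one for each edge of $G_1$), and joining the two end vertices of the $i$-th edge of $G_1$ to every vertex of the $i$-th copy of $G_2$.
   Formalization: The formal statement additionally assumes 1+βΓ_{A_α(G_2)}(ν−2α) ≠ 0, since the displayed formula divides by this quantity, which can vanish at a ν that is not a pole (e.g. G_2=K_1, α<1, ν=3α−1). *)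

theory Defs
  imports
    "HOL-Complex_Analysis.Complex_Analysis"
    "Graph_Theory.Graph_Theory"
    "Jordan_Normal_Form.Gauss_Jordan_Elimination"
    "Jordan_Normal_Form.Determinant"
begin

text \<open>A finite simple undirected graph is a \<^const>\<open>pair_graph\<close>, i.e. a finite loop-free symmetric
  digraph without parallel arcs. An undirected edge \<open>{u, v}\<close> is the pair of arcs
  \<open>(u, v)\<close>, \<open>(v, u)\<close>, so the degree of a vertex is its out-degree.
  Connectedness is \<^const>\<open>Digraph_Component.connected\<close>, which includes that there is a vertex.\<close>

definition edge_set :: "'a pair_pre_digraph \<Rightarrow> 'a set set" where
  "edge_set G = (\<lambda>(u, v). {u, v}) ` parcs G"

definition regular_graph :: "'a pair_pre_digraph \<Rightarrow> nat \<Rightarrow> bool" where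
  "regular_graph G k \<longleftrightarrow> (\<forall>v \<in> pverts G. out_degree (with_proj G) v = k)"

definition edge_corona ::
  "'a pair_pre_digraph \<Rightarrow> 'b pair_pre_digraph \<Rightarrow> ('a + 'a set \<times> 'b) pair_pre_digraph" where
  "edge_corona G H = \<lparr>
     pverts = Inl ` pverts G \<union> Inr ` (edge_set G \<times> pverts H),
     parcs = {(Inl u, Inl v) | u v. (u, v) \<in> parcs G}
           \<union> {(Inr (e, x), Inr (e, y)) | e x y. e \<in> edge_set G \<and> (x, y) \<in> parcs H}
           \<union> {(Inl u, Inr (e, x)) | u e x. e \<in> edge_set G \<and> u \<in> e \<and> x \<in> pverts H}
           \<union> {(Inr (e, x), Inl u) | u e x. e \<in> edge_set G \<and> u \<in> e \<and> x \<in> pverts H}\<rparr>"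

text \<open>The matrices of a graph are taken with respect to an enumeration of its vertices.
  They have real entries, but are complex matrices so that the variable of characteristic
  polynomials and coronals can range over the complex numbers.\<close>

definition vertex_enum :: "'a pair_pre_digraph \<Rightarrow> 'a list \<Rightarrow> bool" where
  "vertex_enum G vs \<longleftrightarrow> distinct vs \<and> set vs = pverts G"

definition adj_matrix :: "'a pair_pre_digraph \<Rightarrow> 'a list \<Rightarrow> complex Matrix.mat" where
  "adj_matrix G vs = Matrix.mat (length vs) (length vs)
     (\<lambda>(i, j). if (vs ! i, vs ! j) \<in> parcs G then 1 else 0)"

definition deg_matrix :: "'a pair_pre_digraph \<Rightarrow> 'a list \<Rightarrow> complex Matrix.mat" where
  "deg_matrix G vs = Matrix.mat (length vs) (length vs)
     (\<lambda>(i, j). if i = j then of_nat (out_degree (with_proj G) (vs ! i)) else 0)"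

definition A_alpha :: "real \<Rightarrow> 'a pair_pre_digraph \<Rightarrow> 'a list \<Rightarrow> complex Matrix.mat" where
  "A_alpha \<alpha> G vs = complex_of_real \<alpha> \<cdot>\<^sub>m deg_matrix G vs
     + complex_of_real (1 - \<alpha>) \<cdot>\<^sub>m adj_matrix G vs"

definition char_fun :: "complex Matrix.mat \<Rightarrow> complex \<Rightarrow> complex" where
  "char_fun M \<theta> = Determinant.det (\<theta> \<cdot>\<^sub>m 1\<^sub>m (dim_row M) - M)"

definition ones_vec :: "nat \<Rightarrow> complex Matrix.vec" where
  "ones_vec n = Matrix.vec n (\<lambda>_. 1)"

text \<open>The defining expression of the coronal, with the junk value \<open>0\<close> at the finitely many
  \<open>\<theta>\<close> for which \<open>\<theta> I - M\<close> is singular.\<close>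

definition coronal_expr :: "complex Matrix.mat \<Rightarrow> complex \<Rightarrow> complex" where
  "coronal_expr M \<theta> =
     (case mat_inverse (\<theta> \<cdot>\<^sub>m 1\<^sub>m (dim_row M) - M) of
        Some B \<Rightarrow> scalar_prod (ones_vec (dim_row M)) (B *\<^sub>v ones_vec (dim_row M))
      | None \<Rightarrow> 0)"

text \<open>The coronal is a rational function of \<open>\<theta>\<close>. Not every eigenvalue of \<open>M\<close> need be a pole of it
  (for constant row sums \<open>r\<close> it is \<open>n / (\<theta> - r)\<close>); at the other eigenvalues its
  value is the limit, as provided by \<^const>\<open>remove_sings\<close>.\<close>

definition coronal :: "complex Matrix.mat \<Rightarrow> complex \<Rightarrow> complex" where
  "coronal M = remove_sings (coronal_expr M)"

end

theory Submission
  imports Defs "Jordan_Normal_Form.Char_Poly"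
begin

text \<open>Order the vertices of the edge corona as the vertices of \<open>G\<^sub>1\<close> followed by the copies of
  \<open>G\<^sub>2\<close>. Where \<open>\<nu> - 2\<alpha>\<close> is not an eigenvalue of \<open>A\<^sub>\<alpha>(G\<^sub>2)\<close>, the copy at an edge \<open>e\<close> is eliminated
  by a Schur complement, which contributes a factor \<open>f(\<nu> - 2\<alpha>)\<close> and subtracts
  \<open>\<beta>\<^sup>2 \<Gamma> r\<^sub>e r\<^sub>e\<^sup>T\<close> from the block of \<open>G\<^sub>1\<close>, where \<open>r\<^sub>e\<close> is the indicator vector of \<open>e\<close>. By
  regularity the sum of the matrices \<open>r\<^sub>e r\<^sub>e\<^sup>T\<close> is \<open>k\<^sub>1 I + A(G\<^sub>1)\<close>, so what remains is a multiple of a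
  characteristic matrix of \<open>A\<^sub>\<alpha>(G\<^sub>1)\<close>. At the other admissible \<open>\<nu>\<close> the coronal, a rational function
  without a pole there, is continuous, and both sides of the formula are compared in the limit.\<close>

section \<open>Determinants and inverses\<close>

lemma det_four_block_mat_schur:
  fixes A :: "'a :: idom mat"
  assumes A: "A \<in> carrier_mat n n" and B: "B \<in> carrier_mat n m"
    and C: "C \<in> carrier_mat m n" and D: "D \<in> carrier_mat m m"
    and E: "E \<in> carrier_mat m m" and DE: "D * E = 1\<^sub>m m"
  shows "det (four_block_mat A B C D) = det (A - B * (E * C)) * det D"
proof -
  define W where "W = E * C"
  let ?S = "A - B * W"
  let ?U = "four_block_mat ?S B (0\<^sub>m m n) D"
    and ?L = "four_block_mat (1\<^sub>m n) (0\<^sub>m n m) W (1\<^sub>m m)"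
  have W: "W \<in> carrier_mat m n" and S: "?S \<in> carrier_mat n n"
    using A B C E by (auto simp: W_def)
  have DW: "D * W = C"
    using assoc_mult_mat[OF D E C] DE C by (simp add: W_def)
  have "?S + B * W = A"
    using A B W by (intro eq_matI) auto
  then have "?U * ?L = four_block_mat A B C D"
    using B C D W S by (subst mult_four_block_mat[of _ n n _ m _ m _ _ n _ m]) (auto simp: DW)
  moreover have "det (?U * ?L) = det ?U * det ?L"
    using S D by (intro det_mult[of _ "n + m"]) auto
  moreover have "det ?U = det ?S * det D"
    using det_four_block_mat_lower_left_zero[OF S B refl D] .
  moreover have "det ?L = 1"
    using W by (subst det_four_block_mat_upper_right_zero[of _ n _ m]) auto
  ultimately show ?thesis
    by (simp add: W_def)
qed

lemma det_permute_rows_cols: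
  assumes A: "A \<in> carrier_mat n n" and p: "p permutes {0..<n}"
  shows "det (mat n n (\<lambda>(i, j). A $$ (p i, p j))) = det A"
proof -
  have p_less: "p i < n" if "i < n" for i
    using permutes_in_image[OF p, of i] that by simp
  define B where "B = mat n n (\<lambda>(i, j). A\<^sup>T $$ (p i, j))"
  have B: "B \<in> carrier_mat n n" by (simp add: B_def)
  have "mat n n (\<lambda>(i, j). A $$ (p i, p j)) = mat n n (\<lambda>(i, j). B\<^sup>T $$ (p i, j))"
    using A by (intro eq_matI) (auto simp: B_def p_less)
  then have "det (mat n n (\<lambda>(i, j). A $$ (p i, p j))) = signof p * det B"
    using B p by (simp add: det_permute_rows det_transpose)
  also have "det B = signof p * det A"
    using A p by (simp add: B_def det_permute_rows det_transpose)
  finally show ?thesis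
    by (simp add: sign_def flip: mult.assoc of_int_mult)
qed

text \<open>By Cramer's rule this is the sum of the entries of the inverse. As \<open>x / 0 = 0\<close>, it is \<open>0\<close> for
  a singular matrix, in agreement with the junk value in \<^const>\<open>coronal_expr\<close>.\<close>

definition sum_mat_inverse :: "'a :: field mat \<Rightarrow> 'a" where
  "sum_mat_inverse A = sum_mat (adj_mat A) / det A"

lemma sum_mat_eq_double_sum:
  "A \<in> carrier_mat n m \<Longrightarrow> sum_mat A = (\<Sum>i<n. \<Sum>j<m. A $$ (i, j))"
  by (simp add: sum_mat_def sum.cartesian_product lessThan_atLeast0)

lemma sum_mat_smult: "sum_mat (c \<cdot>\<^sub>m A) = c * sum_mat (A :: 'a :: semiring_0 mat)"
  by (auto simp: sum_mat_def sum_distrib_left intro!: sum.cong)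

lemma sum_mat_right_inverse:
  assumes A: "A \<in> carrier_mat n n" and E: "E \<in> carrier_mat n n" and AE: "A * E = 1\<^sub>m n"
  shows "sum_mat E = sum_mat_inverse A"
proof -
  note adj = adj_mat[OF A]
  have "adj_mat A = adj_mat A * (A * E)"
    using adj(1) by (simp add: AE)
  also have "\<dots> = det A \<cdot>\<^sub>m E"
    using assoc_mult_mat[OF adj(1) A E] E
    by (simp add: adj(3) mult_smult_assoc_mat[OF one_carrier_mat])
  finally have "adj_mat A = det A \<cdot>\<^sub>m E" .
  moreover have "det A \<noteq> 0"
    using det_mult[OF A E] by (auto simp: AE)
  ultimately show ?thesis
    by (simp add: sum_mat_inverse_def sum_mat_smult)
qed

lemma (in comm_ring_hom) hom_adj_mat:
  assumes "A \<in> carrier_mat n n"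
  shows "adj_mat (map_mat hom A) = map_mat hom (adj_mat A)"
proof -
  have "mat_delete (map_mat hom A) i j = map_mat hom (mat_delete A i j)" for i j
    by (intro eq_matI) (auto simp: mat_delete_def)
  then have "cofactor (map_mat hom A) i j = hom (cofactor A i j)" for i j
    by (simp add: cofactor_def hom_distribs)
  then show ?thesis
    using assms by (intro eq_matI) (auto simp: adj_mat_def)
qed

section \<open>Matrices over an enumeration\<close>

definition enum_mat :: "('a \<Rightarrow> 'a \<Rightarrow> 'c) \<Rightarrow> 'a list \<Rightarrow> 'c mat" where
  "enum_mat F xs = mat (length xs) (length xs) (\<lambda>(i, j). F (xs ! i) (xs ! j))"

lemma enum_mat_carrier [simp]: "enum_mat F xs \<in> carrier_mat (length xs) (length xs)"
  and dim_row_enum_mat [simp]: "dim_row (enum_mat F xs) = length xs"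
  and dim_col_enum_mat [simp]: "dim_col (enum_mat F xs) = length xs"
  by (simp_all add: enum_mat_def)

lemma index_enum_mat [simp]:
  "i < length xs \<Longrightarrow> j < length xs \<Longrightarrow> enum_mat F xs $$ (i, j) = F (xs ! i) (xs ! j)"
  by (simp add: enum_mat_def)

lemma enum_mat_cong:
  "(\<And>x y. x \<in> set xs \<Longrightarrow> y \<in> set xs \<Longrightarrow> F x y = G x y) \<Longrightarrow> enum_mat F xs = enum_mat G xs"
  by (intro eq_matI) auto

lemma enum_mat_map: "enum_mat F (map f xs) = enum_mat (\<lambda>x y. F (f x) (f y)) xs"
  by (intro eq_matI) auto

lemma det_enum_mat_scale:
  fixes c :: "'c :: comm_ring_1"
  shows "det (enum_mat (\<lambda>x y. c * F x y) xs) = c ^ length xs * det (enum_mat F xs)"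
proof -
  have "enum_mat (\<lambda>x y. c * F x y) xs = c \<cdot>\<^sub>m enum_mat F xs"
    by (intro eq_matI) auto
  then show ?thesis by simp
qed

lemma det_enum_mat_mset_eq:
  fixes F :: "'a \<Rightarrow> 'a \<Rightarrow> 'c :: comm_ring_1"
  assumes "mset xs = mset ys"
  shows "det (enum_mat F xs) = det (enum_mat F ys)"
proof -
  obtain p where p: "p permutes {..<length ys}" and xs: "permute_list p ys = xs"
    using mset_eq_permutation[OF assms] by blast
  let ?n = "length ys"
  have "p i < ?n" if "i < ?n" for i
    using permutes_in_image[OF p, of i] that by simp
  then have "enum_mat F xs = mat ?n ?n (\<lambda>(i, j). enum_mat F ys $$ (p i, p j))"
    using p by (intro eq_matI) (auto simp: permute_list_nth simp flip: xs)
  then show ?thesis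
    using p by (simp add: det_permute_rows_cols lessThan_atLeast0)
qed

lemma det_enum_mat_append:
  fixes F :: "'a \<Rightarrow> 'a \<Rightarrow> 'c :: field"
  assumes nz: "det (enum_mat F ys) \<noteq> 0"
    and b: "\<And>x y. x \<in> set xs \<Longrightarrow> y \<in> set ys \<Longrightarrow> F x y = b x"
    and c: "\<And>x y. x \<in> set xs \<Longrightarrow> y \<in> set ys \<Longrightarrow> F y x = c x"
  shows "det (enum_mat F (xs @ ys))
    = det (enum_mat (\<lambda>x y. F x y - sum_mat_inverse (enum_mat F ys) * (b x * c y)) xs)
      * det (enum_mat F ys)"
proof -
  let ?n = "length xs" and ?m = "length ys"
  let ?B = "mat ?n ?m (\<lambda>(i, j). b (xs ! i))" and ?C = "mat ?m ?n (\<lambda>(i, j). c (xs ! j))"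
  let ?D = "enum_mat F ys"
  obtain E where E: "E \<in> carrier_mat ?m ?m" and DE: "?D * E = 1\<^sub>m ?m"
    using det_non_zero_imp_unit[OF enum_mat_carrier nz, of "()"]
    by (auto simp: Units_def ring_mat_def)
  have s: "sum_mat_inverse ?D = (\<Sum>i<?m. \<Sum>j<?m. E $$ (i, j))"
    using sum_mat_right_inverse[OF enum_mat_carrier E DE] sum_mat_eq_double_sum[OF E] by simp
  have "(?B * (E * ?C)) $$ (i, j) = sum_mat_inverse ?D * (b (xs ! i) * c (xs ! j))"
    if "i < ?n" "j < ?n" for i j
    using that E
    by (auto simp: scalar_prod_def s sum_distrib_left sum_distrib_right lessThan_atLeast0 ac_simps
        intro!: sum.cong)
  then have schur: "enum_mat F xs - ?B * (E * ?C)
      = enum_mat (\<lambda>x y. F x y - sum_mat_inverse ?D * (b x * c y)) xs"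
    using E by (intro eq_matI) auto
  have "enum_mat F (xs @ ys) = four_block_mat (enum_mat F xs) ?B ?C ?D"
    by (intro eq_matI) (auto simp: nth_append b c)
  then show ?thesis
    using E DE by (simp add: det_four_block_mat_schur[of _ ?n _ ?m _ _ E] schur)
qed

lemma det_enum_mat_append_blocks:
  fixes F :: "'a \<Rightarrow> 'a \<Rightarrow> 'c :: field"
  assumes "distinct es"
    and "\<And>e. e \<in> set es \<Longrightarrow> enum_mat F (ys e) = D e"
    and "\<And>e. e \<in> set es \<Longrightarrow> det (D e) \<noteq> 0"
    and "\<And>e. e \<in> set es \<Longrightarrow> set us \<inter> set (ys e) = {}"
    and "\<And>e u y. e \<in> set es \<Longrightarrow> u \<in> set us \<Longrightarrow> y \<in> set (ys e) \<Longrightarrow> F u y = b e u"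
    and "\<And>e u y. e \<in> set es \<Longrightarrow> u \<in> set us \<Longrightarrow> y \<in> set (ys e) \<Longrightarrow> F y u = c e u"
    and "\<And>e f x y. e \<in> set es \<Longrightarrow> f \<in> set es \<Longrightarrow> e \<noteq> f
      \<Longrightarrow> x \<in> set (ys e) \<Longrightarrow> y \<in> set (ys f) \<Longrightarrow> F x y = 0"
  shows "det (enum_mat F (us @ concat (map ys es)))
    = (\<Prod>e\<in>set es. det (D e))
      * det (enum_mat (\<lambda>u v. F u v - (\<Sum>e\<in>set es. sum_mat_inverse (D e) * (b e u * c e v))) us)"
  using assms
proof (induction es arbitrary: F rule: rev_induct)
  case Nil
  show ?case by simp
next
  case (snoc f es)
  note blocks = snoc.prems(2,3) and disjoint = snoc.prems(4) and borders = snoc.prems(5,6)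
    and off_diagonal = snoc.prems(7)
  have f: "f \<notin> set es" and es: "distinct es"
    using snoc.prems(1) by auto
  let ?zs = "us @ concat (map ys es)"
  let ?b = "\<lambda>x. if x \<in> set us then b f x else 0" and ?c = "\<lambda>x. if x \<in> set us then c f x else 0"
  define F' where "F' = (\<lambda>x y. F x y - sum_mat_inverse (D f) * (?b x * ?c y))"
  have "F x y = ?b x \<and> F y x = ?c x" if "x \<in> set ?zs" "y \<in> set (ys f)" for x y
  proof (cases "x \<in> set us")
    case True
    then show ?thesis using that borders[of f x y] by simp
  next
    case False
    with that obtain e where "e \<in> set es" "x \<in> set (ys e)" by auto
    then show ?thesis
      using that f False off_diagonal[of e f x y] off_diagonal[of f e y x] by auto
  qed
  then have "det (enum_mat F (?zs @ ys f)) = det (enum_mat F' ?zs) * det (D f)"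
    using blocks[of f] det_enum_mat_append[of F "ys f" ?zs ?b ?c] by (simp add: F'_def)
  moreover have F'_eq: "F' x y = F x y" "F' y x = F y x"
    if "e \<in> set es" "y \<in> set (ys e)" for e x y
    using that disjoint[of e] by (auto simp: F'_def)
  have "det (enum_mat F' ?zs) = (\<Prod>e\<in>set es. det (D e))
      * det (enum_mat (\<lambda>u v. F' u v - (\<Sum>e\<in>set es. sum_mat_inverse (D e) * (b e u * c e v))) us)"
    using es
  proof (rule snoc.IH)
    show "enum_mat F' (ys e) = D e" if "e \<in> set es" for e
      using that blocks(1)[of e] F'_eq[OF that] enum_mat_cong[of "ys e" F' F] by simp
    show "F' x y = 0"
      if "e \<in> set es" "g \<in> set es" "e \<noteq> g" "x \<in> set (ys e)" "y \<in> set (ys g)" for e g x y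
      using that off_diagonal[of e g x y] F'_eq[of e x y] by simp
  qed (use blocks disjoint borders in \<open>auto simp: F'_eq\<close>)
  moreover have "enum_mat (\<lambda>u v. F' u v
        - (\<Sum>e\<in>set es. sum_mat_inverse (D e) * (b e u * c e v))) us
      = enum_mat (\<lambda>u v. F u v
        - (\<Sum>e\<in>set (es @ [f]). sum_mat_inverse (D e) * (b e u * c e v))) us"
    using f by (intro enum_mat_cong) (simp add: F'_def algebra_simps)
  ultimately show ?case
    using f by (simp add: mult_ac)
qed

section \<open>The coronal as a rational function\<close>

lemma map_mat_poly_char_poly_matrix:
  assumes "M \<in> carrier_mat n n"
  shows "map_mat (\<lambda>p. poly p \<theta>) (char_poly_matrix M) = \<theta> \<cdot>\<^sub>m 1\<^sub>m n - M"
  using assms by (intro eq_matI) (auto simp: char_poly_matrix_def)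

lemma char_fun_eq_poly:
  assumes "M \<in> carrier_mat n n"
  shows "char_fun M \<theta> = poly (char_poly M) \<theta>"
  using assms map_mat_poly_char_poly_matrix[OF assms, of \<theta>]
    comm_ring_hom.hom_det[OF poly_hom.comm_ring_hom_axioms, of \<theta> "char_poly_matrix M"]
  by (simp add: char_fun_def char_poly_def)

lemma tendsto_char_fun [tendsto_intros]:
  assumes "(f \<longlongrightarrow> a) F"
  shows "((\<lambda>x. char_fun M (f x)) \<longlongrightarrow> char_fun M a) F"
proof (cases "dim_row M = dim_col M")
  case True
  then have "M \<in> carrier_mat (dim_row M) (dim_row M)" by auto
  then show ?thesis
    using tendsto_poly[OF assms] by (simp add: char_fun_eq_poly)
next
  case False
  then show ?thesis
    by (simp add: char_fun_def det_def)
qed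

lemma eventually_char_fun_shift_nonzero:
  assumes "M \<in> carrier_mat n n"
  shows "\<forall>\<^sub>F w in at z. char_fun M (w - c) \<noteq> 0"
proof -
  have "char_poly M \<noteq> 0"
    using degree_monic_char_poly[OF assms] by auto
  then have "\<not> (z - c) islimpt {w. char_fun M w = 0}"
    by (simp add: char_fun_eq_poly[OF assms] poly_roots_finite islimpt_finite)
  then have "\<forall>\<^sub>F w in filtermap (\<lambda>w. w - c) (at z). char_fun M w \<noteq> 0"
    by (simp add: islimpt_iff_eventually filtermap_at_shift)
  then show ?thesis
    by (simp add: eventually_filtermap)
qed

lemma coronal_expr_eq_sum_mat_inverse:
  assumes M: "M \<in> carrier_mat n n"
  shows "coronal_expr M \<theta> = sum_mat_inverse (\<theta> \<cdot>\<^sub>m 1\<^sub>m n - M)"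
proof -
  let ?D = "\<theta> \<cdot>\<^sub>m 1\<^sub>m n - M"
  have D: "?D \<in> carrier_mat n n" using M by auto
  show ?thesis
  proof (cases "mat_inverse ?D")
    case None
    then have "det ?D = 0"
      using mat_inverse(1)[OF D, of "()"] det_non_zero_imp_unit[OF D, of "()"] by blast
    then show ?thesis
      using M None by (simp add: coronal_expr_def sum_mat_inverse_def)
  next
    case (Some E)
    note E = mat_inverse(2)[OF D Some]
    have "ones_vec n \<bullet> (E *\<^sub>v ones_vec n) = sum_mat E"
      using E by (auto simp: ones_vec_def scalar_prod_def sum_mat_eq_double_sum[of E n n]
          lessThan_atLeast0 intro!: sum.cong)
    then show ?thesis
      using M Some E sum_mat_right_inverse[OF D] by (simp add: coronal_expr_def)
  qed
qed

lemma coronal_expr_eq_rational: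
  assumes M: "M \<in> carrier_mat n n"
  shows "coronal_expr M
    = (\<lambda>\<theta>. poly (sum_mat (adj_mat (char_poly_matrix M))) \<theta> / poly (char_poly M) \<theta>)"
proof
  fix \<theta>
  have "coronal_expr M \<theta>
      = sum_mat_inverse (map_mat (\<lambda>p. poly p \<theta>) (char_poly_matrix M))"
    using M by (simp add: coronal_expr_eq_sum_mat_inverse map_mat_poly_char_poly_matrix)
  then show "coronal_expr M \<theta>
      = poly (sum_mat (adj_mat (char_poly_matrix M))) \<theta> / poly (char_poly M) \<theta>"
    using M by (simp add: sum_mat_inverse_def char_poly_def poly_hom.hom_adj_mat[of _ n]
        semiring_hom.hom_sum_mat[OF poly_hom.semiring_hom_axioms]
        comm_ring_hom.hom_det[OF poly_hom.comm_ring_hom_axioms])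
qed

lemma poly_meromorphic_on: "poly p meromorphic_on A"
  for p :: "complex poly"
proof -
  have "(\<lambda>z. poly p z) holomorphic_on UNIV"
    by (intro holomorphic_intros)
  then have "poly p analytic_on UNIV"
    by (simp add: analytic_on_open)
  then show ?thesis
    by (intro analytic_on_imp_meromorphic_on) (rule analytic_on_subset[OF _ subset_UNIV])
qed

lemma tendsto_coronal_expr:
  assumes M: "M \<in> carrier_mat n n" and "\<not> is_pole (coronal M) z"
  shows "coronal_expr M \<midarrow>z\<rightarrow> coronal M z"
proof -
  have mero: "coronal_expr M meromorphic_on {z}"
    unfolding coronal_expr_eq_rational[OF M] by (intro meromorphic_on_divide poly_meromorphic_on)
  have "remove_sings (coronal_expr M) \<midarrow>z\<rightarrow> remove_sings (coronal_expr M) z"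
    using remove_sings_nicely_meromorphic[OF mero] assms(2)
    unfolding nicely_meromorphic_on_def coronal_def by blast
  then show ?thesis
    unfolding coronal_def
    using tendsto_remove_sings_iff[OF meromorphic_on_isolated_singularity[OF mero]] by blast
qed

lemma tendsto_coronal_expr_shift:
  assumes M: "M \<in> carrier_mat n n" and "\<not> is_pole (\<lambda>w. coronal M (w - c)) z"
  shows "((\<lambda>w. coronal_expr M (w - c)) \<longlongrightarrow> coronal M (z - c)) (at z)"
proof -
  have shift: "filtermap (\<lambda>w. w - c) (at z) = at (z - c)"
    by (rule filtermap_at_shift)
  have "\<not> is_pole (coronal M) (z - c)"
    using assms(2) is_pole_compose_iff[OF shift, of "coronal M"] by (simp add: comp_def)
  then have "coronal_expr M \<midarrow>z - c\<rightarrow> coronal M (z - c)"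
    by (rule tendsto_coronal_expr[OF M])
  then show ?thesis
    by (rule filterlim_compose) (simp add: filterlim_def shift)
qed

section \<open>Edges and degrees\<close>

lemma out_degree_with_proj: "out_degree (with_proj G) u = card {v. (u, v) \<in> parcs G}"
proof -
  have "out_arcs (with_proj G) u = Pair u ` {v. (u, v) \<in> parcs G}"
    by (auto simp: out_arcs_def)
  then show ?thesis
    by (simp add: out_degree_def card_image inj_on_def)
qed

lemma edge_set_iff: "e \<in> edge_set G \<longleftrightarrow> (\<exists>u v. (u, v) \<in> parcs G \<and> e = {u, v})"
  by (auto simp: edge_set_def)

lemma (in pair_fin_digraph) finite_edge_set: "finite (edge_set G)"
  unfolding edge_set_def using pair_finite_arcs by simp

lemma (in pair_fin_digraph) finite_out_neighbours: "finite {v. (u, v) \<in> parcs G}"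
  by (rule finite_subset[OF _ pair_finite_verts]) (auto dest: in_arcsD2)

lemma (in pair_loopfree_digraph) card_edge: "e \<in> edge_set G \<Longrightarrow> card e = 2"
  by (auto simp: edge_set_iff card_insert_if dest: no_loops')

lemma (in pair_sym_digraph) card_edges_incident:
  "card {e \<in> edge_set G. u \<in> e} = out_degree (with_proj G) u"
proof -
  have "{e \<in> edge_set G. u \<in> e} = (\<lambda>v. {u, v}) ` {v. (u, v) \<in> parcs G}"
    by (auto simp: edge_set_iff dest: arcs_symmetric)
  moreover have "inj_on (\<lambda>v. {u, v}) {v. (u, v) \<in> parcs G}"
    by (auto simp: inj_on_def doubleton_eq_iff)
  ultimately show ?thesis
    by (simp add: card_image out_degree_with_proj)
qed

lemma (in pair_sym_digraph) card_edges_joining: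
  assumes "u \<noteq> v"
  shows "card {e \<in> edge_set G. u \<in> e \<and> v \<in> e} = of_bool ((u, v) \<in> parcs G)"
proof -
  have "{e \<in> edge_set G. u \<in> e \<and> v \<in> e} = (if (u, v) \<in> parcs G then {{u, v}} else {})"
    using assms by (auto simp: edge_set_iff dest: arcs_symmetric)
  then show ?thesis by simp
qed

lemma (in pair_fin_digraph) sum_edge_indicators:
  fixes b :: "'c :: comm_semiring_1"
  shows "(\<Sum>e\<in>edge_set G. (if u \<in> e then b else 0) * (if v \<in> e then b else 0))
    = b\<^sup>2 * of_nat (card {e \<in> edge_set G. u \<in> e \<and> v \<in> e})"
proof -
  have "(\<Sum>e\<in>edge_set G. (if u \<in> e then b else 0) * (if v \<in> e then b else 0))
      = (\<Sum>e\<in>edge_set G. if u \<in> e \<and> v \<in> e then b\<^sup>2 else 0)"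
    by (intro sum.cong) (auto simp: power2_eq_square)
  also have "\<dots> = b\<^sup>2 * of_nat (card {e \<in> edge_set G. u \<in> e \<and> v \<in> e})"
    using finite_edge_set by (simp add: sum.If_cases Int_def mult.commute)
  finally show ?thesis .
qed

lemma parcs_edge_corona:
  "(Inl u, Inl v) \<in> parcs (edge_corona G H) \<longleftrightarrow> (u, v) \<in> parcs G"
  "(Inl u, Inr (e, x)) \<in> parcs (edge_corona G H) \<longleftrightarrow> e \<in> edge_set G \<and> u \<in> e \<and> x \<in> pverts H"
  "(Inr (e, x), Inl u) \<in> parcs (edge_corona G H) \<longleftrightarrow> e \<in> edge_set G \<and> u \<in> e \<and> x \<in> pverts H"
  "(Inr (e, x), Inr (f, y)) \<in> parcs (edge_corona G H)
    \<longleftrightarrow> e = f \<and> e \<in> edge_set G \<and> (x, y) \<in> parcs H"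
  by (auto simp: edge_corona_def)

lemma (in pair_pseudo_graph) out_degree_edge_corona_Inl:
  assumes "finite (pverts H)"
  shows "out_degree (with_proj (edge_corona G H)) (Inl u)
    = out_degree (with_proj G) u * (1 + card (pverts H))"
proof -
  let ?N = "{v. (u, v) \<in> parcs G}" and ?I = "{e \<in> edge_set G. u \<in> e}"
  have "{w. (Inl u, w) \<in> parcs (edge_corona G H)} = Inl ` ?N \<union> Inr ` (?I \<times> pverts H)"
    by (auto simp: edge_corona_def)
  also have "card \<dots> = card ?N + card ?I * card (pverts H)"
    using assms finite_out_neighbours finite_edge_set
    by (subst card_Un_disjoint) (auto simp: card_image card_cartesian_product)
  finally show ?thesis
    by (simp add: out_degree_with_proj card_edges_incident)
qed

lemma (in pair_loopfree_digraph) out_degree_edge_corona_Inr: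
  assumes "pair_fin_digraph H" and e: "e \<in> edge_set G" and x: "x \<in> pverts H"
  shows "out_degree (with_proj (edge_corona G H)) (Inr (e, x)) = out_degree (with_proj H) x + 2"
proof -
  let ?N = "{y. (x, y) \<in> parcs H}"
  have fin: "finite ?N" "finite e"
    using pair_fin_digraph.finite_out_neighbours[OF assms(1)] card_edge[OF e]
    by (auto intro: card_ge_0_finite)
  have "{w. (Inr (e, x), w) \<in> parcs (edge_corona G H)} = (\<lambda>y. Inr (e, y)) ` ?N \<union> Inl ` e"
    using e x by (auto simp: edge_corona_def)
  also have "card \<dots> = card ?N + card e"
    using fin by (subst card_Un_disjoint) (auto simp: card_image inj_on_def)
  finally show ?thesis
    by (simp add: out_degree_with_proj card_edge[OF e])
qed

section \<open>The characteristic function of an edge corona\<close>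

definition char_entry :: "real \<Rightarrow> 'a pair_pre_digraph \<Rightarrow> complex \<Rightarrow> 'a \<Rightarrow> 'a \<Rightarrow> complex" where
  "char_entry \<alpha> G \<theta> u v =
     (if u = v then \<theta> - of_real \<alpha> * of_nat (out_degree (with_proj G) u) else 0)
     - (if (u, v) \<in> parcs G then of_real (1 - \<alpha>) else 0)"

lemma A_alpha_carrier [simp]: "A_alpha \<alpha> G vs \<in> carrier_mat (length vs) (length vs)"
  by (simp add: A_alpha_def deg_matrix_def adj_matrix_def)

lemma char_matrix_A_alpha:
  assumes "distinct vs"
  shows "\<theta> \<cdot>\<^sub>m 1\<^sub>m (length vs) - A_alpha \<alpha> G vs = enum_mat (char_entry \<alpha> G \<theta>) vs"
  using assms
  by (intro eq_matI)
    (auto simp: A_alpha_def deg_matrix_def adj_matrix_def char_entry_def nth_eq_iff_index_eq)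

lemma char_fun_A_alpha:
  "distinct vs \<Longrightarrow> char_fun (A_alpha \<alpha> G vs) \<theta> = det (enum_mat (char_entry \<alpha> G \<theta>) vs)"
  by (simp add: char_fun_def char_matrix_A_alpha carrier_matD(1)[OF A_alpha_carrier])

lemma coronal_expr_A_alpha:
  "distinct vs
    \<Longrightarrow> coronal_expr (A_alpha \<alpha> G vs) \<theta> = sum_mat_inverse (enum_mat (char_entry \<alpha> G \<theta>) vs)"
  by (simp add: coronal_expr_eq_sum_mat_inverse[OF A_alpha_carrier] char_matrix_A_alpha)

lemma char_fun_A_alpha_vertex_enum:
  assumes "vertex_enum G vs" and "vertex_enum G ws"
  shows "char_fun (A_alpha \<alpha> G vs) \<theta> = char_fun (A_alpha \<alpha> G ws) \<theta>"
proof -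
  have "mset vs = mset ws"
    using assms set_eq_iff_mset_eq_distinct[of vs ws] by (simp add: vertex_enum_def)
  then show ?thesis
    using assms det_enum_mat_mset_eq by (auto simp: char_fun_A_alpha vertex_enum_def)
qed

lemma vertex_enum_edge_corona:
  assumes "vertex_enum G us" and "vertex_enum H xs" and "distinct es" and "set es = edge_set G"
  shows "vertex_enum (edge_corona G H) (map Inl us @ map Inr (List.product es xs))"
  using assms
  by (auto simp: vertex_enum_def edge_corona_def distinct_map distinct_product)

lemma (in pair_graph) char_entry_edge_corona_Inl_Inr:
  assumes "e \<in> edge_set G" and "x \<in> pverts H"
  shows "char_entry \<alpha> (edge_corona G H) z (Inl u) (Inr (e, x))
      = (if u \<in> e then - of_real (1 - \<alpha>) else 0)"
    and "char_entry \<alpha> (edge_corona G H) z (Inr (e, x)) (Inl u)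
      = (if u \<in> e then - of_real (1 - \<alpha>) else 0)"
  using assms by (simp_all add: char_entry_def parcs_edge_corona)

lemma (in pair_graph) char_entry_edge_corona_Inr_Inr:
  assumes "pair_fin_digraph H" and "e \<in> edge_set G" and "x \<in> pverts H"
  shows "char_entry \<alpha> (edge_corona G H) z (Inr (e, x)) (Inr (f, y))
    = (if e = f then char_entry \<alpha> H (z - 2 * of_real \<alpha>) x y else 0)"
  using assms
  by (auto simp: char_entry_def parcs_edge_corona out_degree_edge_corona_Inr algebra_simps)

definition corona_schur_entry ::
  "real \<Rightarrow> 'a pair_pre_digraph \<Rightarrow> 'b pair_pre_digraph \<Rightarrow> complex \<Rightarrow> complex \<Rightarrow> 'a \<Rightarrow> 'a \<Rightarrow> complex" where
  "corona_schur_entry \<alpha> G H z s u v = char_entry \<alpha> (edge_corona G H) z (Inl u) (Inl v)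
     - of_real (1 - \<alpha>) ^ 2 * s * of_nat (card {e \<in> edge_set G. u \<in> e \<and> v \<in> e})"

lemma (in pair_graph) det_char_entry_edge_corona:
  fixes \<alpha> :: real and z :: complex and H :: "'b pair_pre_digraph" and xs :: "'b list"
  assumes H: "pair_fin_digraph H" and es: "distinct es" "set es = edge_set G"
    and xs: "set xs = pverts H"
  defines "D \<equiv> enum_mat (char_entry \<alpha> H (z - 2 * of_real \<alpha>)) xs"
  assumes nz: "det D \<noteq> 0"
  shows "det (enum_mat (char_entry \<alpha> (edge_corona G H) z)
      (map Inl us @ map Inr (List.product es xs)))
    = det D ^ card (edge_set G)
      * det (enum_mat (corona_schur_entry \<alpha> G H z (sum_mat_inverse D)) us)"
proof -
  let ?F = "char_entry \<alpha> (edge_corona G H) z" and ?\<beta> = "complex_of_real (1 - \<alpha>)"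
  let ?copy = "\<lambda>e. map (\<lambda>x. Inr (e, x)) xs"
  let ?r = "\<lambda>e. case_sum (\<lambda>u. if u \<in> e then - ?\<beta> else 0) (\<lambda>_ :: 'a set \<times> 'b. 0)"
  let ?S = "\<lambda>u v. ?F u v - (\<Sum>e\<in>set es. sum_mat_inverse D * (?r e u * ?r e v))"
  have copy: "enum_mat ?F (?copy e) = D" if "e \<in> edge_set G" for e
    unfolding enum_mat_map D_def using that H xs
    by (intro enum_mat_cong) (simp add: char_entry_edge_corona_Inr_Inr)
  have "det (enum_mat ?F (map Inl us @ concat (map ?copy es)))
      = (\<Prod>e\<in>set es. det D) * det (enum_mat ?S (map Inl us))"
    using H es xs nz
    by (intro det_enum_mat_append_blocks)
      (auto simp: copy char_entry_edge_corona_Inl_Inr char_entry_edge_corona_Inr_Inr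
        split: if_splits)
  also have "enum_mat ?S (map Inl us)
      = enum_mat (corona_schur_entry \<alpha> G H z (sum_mat_inverse D)) us"
  proof (rule trans[OF enum_mat_map enum_mat_cong])
    show "?S (Inl u) (Inl v) = corona_schur_entry \<alpha> G H z (sum_mat_inverse D) u v" for u v
      by (simp add: corona_schur_entry_def es sum_edge_indicators
          flip: sum_distrib_left del: of_real_diff)
  qed
  finally show ?thesis
    by (simp add: es product_concat_map map_concat comp_def)
qed

lemma (in pair_graph) char_fun_edge_corona:
  fixes \<alpha> :: real and z :: complex and H :: "'b pair_pre_digraph" and xs :: "'b list"
  defines "\<theta> \<equiv> z - 2 * of_real \<alpha>"
  assumes H: "pair_fin_digraph H" and us: "vertex_enum G us" and xs: "vertex_enum H xs"
    and vs: "vertex_enum (edge_corona G H) vs"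
    and nz: "char_fun (A_alpha \<alpha> H xs) \<theta> \<noteq> 0"
  shows "char_fun (A_alpha \<alpha> (edge_corona G H) vs) z
    = char_fun (A_alpha \<alpha> H xs) \<theta> ^ card (edge_set G)
      * det (enum_mat (corona_schur_entry \<alpha> G H z (coronal_expr (A_alpha \<alpha> H xs) \<theta>)) us)"
proof -
  obtain es where es: "set es = edge_set G" "distinct es"
    using finite_distinct_list[OF finite_edge_set] by blast
  let ?ws = "map Inl us @ map Inr (List.product es xs)"
  have ws: "vertex_enum (edge_corona G H) ?ws"
    using us xs es by (intro vertex_enum_edge_corona)
  have "char_fun (A_alpha \<alpha> (edge_corona G H) vs) z
      = det (enum_mat (char_entry \<alpha> (edge_corona G H) z) ?ws)"
    using char_fun_A_alpha_vertex_enum[OF vs ws] ws by (simp add: char_fun_A_alpha vertex_enum_def)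
  also have "\<dots> = char_fun (A_alpha \<alpha> H xs) \<theta> ^ card (edge_set G)
      * det (enum_mat (corona_schur_entry \<alpha> G H z (coronal_expr (A_alpha \<alpha> H xs) \<theta>)) us)"
    using det_char_entry_edge_corona[OF H es(2,1), of xs \<alpha> z us] us xs nz
    by (simp add: vertex_enum_def char_fun_A_alpha coronal_expr_A_alpha \<theta>_def)
  finally show ?thesis .
qed

definition corona_argument :: "real \<Rightarrow> nat \<Rightarrow> nat \<Rightarrow> complex \<Rightarrow> complex \<Rightarrow> complex" where
  "corona_argument \<alpha> k n z s =
     (z - of_real \<alpha> * of_nat k * of_nat n + of_real (1 - \<alpha>) * of_nat k * (2 * of_real \<alpha> - 1) * s)
     / (1 + of_real (1 - \<alpha>) * s)"

lemma (in pair_graph) corona_schur_entry_regular: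
  fixes \<alpha> :: real and k :: nat and z s :: complex and H :: "'b pair_pre_digraph"
  defines "t \<equiv> 1 + of_real (1 - \<alpha>) * s"
    and "\<eta> \<equiv> corona_argument \<alpha> k (card (pverts H)) z s"
  assumes H: "finite (pverts H)" and deg: "out_degree (with_proj G) u = k" and t: "t \<noteq> 0"
  shows "corona_schur_entry \<alpha> G H z s u v = t * char_entry \<alpha> G \<eta> u v"
proof (cases "u = v")
  case True
  have "t * \<eta> = z - of_real \<alpha> * of_nat k * of_nat (card (pverts H))
      + of_real (1 - \<alpha>) * of_nat k * (2 * of_real \<alpha> - 1) * s"
    using t by (simp add: \<eta>_def t_def corona_argument_def)
  moreover have "(u, u) \<notin> parcs G"
    using no_loops' by blast
  ultimately show ?thesis
    using True deg card_edges_incident[of u] out_degree_edge_corona_Inl[OF H, of u]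
    by (simp add: corona_schur_entry_def char_entry_def parcs_edge_corona t_def algebra_simps
        power2_eq_square)
next
  case False
  then show ?thesis
    using card_edges_joining[of u v]
    by (simp add: corona_schur_entry_def char_entry_def parcs_edge_corona t_def algebra_simps
        power2_eq_square)
qed

lemma (in pair_graph) char_fun_edge_corona_regular_nonsingular:
  fixes \<alpha> :: real and z :: complex and H :: "'b pair_pre_digraph" and xs :: "'b list"
  defines "s \<equiv> coronal_expr (A_alpha \<alpha> H xs) (z - 2 * of_real \<alpha>)"
  assumes H: "pair_fin_digraph H" and reg: "regular_graph G k"
    and us: "vertex_enum G us" and xs: "vertex_enum H xs"
    and vs: "vertex_enum (edge_corona G H) vs"
    and nz: "char_fun (A_alpha \<alpha> H xs) (z - 2 * of_real \<alpha>) \<noteq> 0"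
    and t: "1 + of_real (1 - \<alpha>) * s \<noteq> 0"
  shows "char_fun (A_alpha \<alpha> (edge_corona G H) vs) z
    = char_fun (A_alpha \<alpha> H xs) (z - 2 * of_real \<alpha>) ^ card (edge_set G)
      * char_fun (A_alpha \<alpha> G us) (corona_argument \<alpha> k (card (pverts H)) z s)
      * (1 + of_real (1 - \<alpha>) * s) ^ card (pverts G)"
proof -
  let ?t = "1 + complex_of_real (1 - \<alpha>) * s" and ?\<eta> = "corona_argument \<alpha> k (card (pverts H)) z s"
  have us_props: "distinct us" "set us = pverts G" "length us = card (pverts G)"
    using us distinct_card[of us] by (auto simp: vertex_enum_def)
  have "enum_mat (corona_schur_entry \<alpha> G H z s) us
      = enum_mat (\<lambda>u v. ?t * char_entry \<alpha> G ?\<eta> u v) us"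
    using pair_fin_digraph.pair_finite_verts[OF H] reg us_props t
    by (intro enum_mat_cong corona_schur_entry_regular) (auto simp: regular_graph_def)
  then have "det (enum_mat (corona_schur_entry \<alpha> G H z s) us)
      = ?t ^ card (pverts G) * char_fun (A_alpha \<alpha> G us) ?\<eta>"
    using us_props by (simp add: det_enum_mat_scale char_fun_A_alpha)
  then show ?thesis
    using char_fun_edge_corona[OF H us xs vs nz] by (simp add: s_def mult_ac)
qed

lemma (in pair_graph) char_fun_edge_corona_regular:
  fixes \<alpha> :: real and z :: complex and H :: "'b pair_pre_digraph" and xs :: "'b list"
  defines "\<Gamma> \<equiv> \<lambda>w. coronal (A_alpha \<alpha> H xs) (w - 2 * of_real \<alpha>)"
  assumes H: "pair_fin_digraph H" and reg: "regular_graph G k"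
    and us: "vertex_enum G us" and xs: "vertex_enum H xs"
    and vs: "vertex_enum (edge_corona G H) vs"
    and pole: "\<not> is_pole \<Gamma> z" and t: "1 + of_real (1 - \<alpha>) * \<Gamma> z \<noteq> 0"
  shows "char_fun (A_alpha \<alpha> (edge_corona G H) vs) z
    = char_fun (A_alpha \<alpha> H xs) (z - 2 * of_real \<alpha>) ^ card (edge_set G)
      * char_fun (A_alpha \<alpha> G us) (corona_argument \<alpha> k (card (pverts H)) z (\<Gamma> z))
      * (1 + of_real (1 - \<alpha>) * \<Gamma> z) ^ card (pverts G)"
proof -
  let ?s = "\<lambda>w. coronal_expr (A_alpha \<alpha> H xs) (w - 2 * of_real \<alpha>)"
  define L where "L = char_fun (A_alpha \<alpha> (edge_corona G H) vs)"
  define R where "R w s = char_fun (A_alpha \<alpha> H xs) (w - 2 * of_real \<alpha>) ^ card (edge_set G)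
    * char_fun (A_alpha \<alpha> G us) (corona_argument \<alpha> k (card (pverts H)) w s)
    * (1 + of_real (1 - \<alpha>) * s) ^ card (pverts G)" for w s
  have s_lim: "(?s \<longlongrightarrow> \<Gamma> z) (at z)"
    using pole unfolding \<Gamma>_def by (rule tendsto_coronal_expr_shift[OF A_alpha_carrier])
  then have "\<forall>\<^sub>F w in at z. 1 + of_real (1 - \<alpha>) * ?s w \<noteq> 0"
    by (intro tendsto_imp_eventually_ne[OF _ t] tendsto_intros)
  with eventually_char_fun_shift_nonzero[OF A_alpha_carrier, of \<alpha> H xs "2 * of_real \<alpha>" z]
  have eq: "\<forall>\<^sub>F w in at z. L w = R w (?s w)"
  proof eventually_elim
    case (elim w)
    then show ?case
      unfolding L_def R_def by (rule char_fun_edge_corona_regular_nonsingular[OF H reg us xs vs])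
  qed
  have "((\<lambda>w. R w (?s w)) \<longlongrightarrow> R z (\<Gamma> z)) (at z)"
    unfolding R_def corona_argument_def by (intro tendsto_intros s_lim t)
  then have "L \<midarrow>z\<rightarrow> R z (\<Gamma> z)"
    using tendsto_cong[OF eq] by blast
  moreover have "L \<midarrow>z\<rightarrow> L z"
    unfolding L_def by (intro tendsto_intros)
  ultimately have "L z = R z (\<Gamma> z)"
    using LIM_unique by blast
  then show ?thesis
    by (simp add: L_def R_def)
qed

theorem theorem4p2:
  fixes G1 :: "'a pair_pre_digraph" and G2 :: "'b pair_pre_digraph"
    and vs1 :: "'a list" and vs2 :: "'b list" and vs :: "('a + 'a set \<times> 'b) list"
    and \<alpha> \<beta> :: real and k1 n1 m1 n2 :: nat and \<nu> :: complex
    and \<Gamma> :: "complex \<Rightarrow> complex"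
  assumes "0 \<le> \<alpha>" and "\<alpha> \<le> 1" and "\<beta> = 1 - \<alpha>"
    and "pair_graph G1" and "Digraph_Component.connected (with_proj G1)"
    and "regular_graph G1 k1"
    and "card (pverts G1) = n1" and "card (edge_set G1) = m1"
    and "pair_graph G2" and "Digraph_Component.connected (with_proj G2)"
    and "card (pverts G2) = n2"
    and "vertex_enum G1 vs1" and "vertex_enum G2 vs2"
    and "vertex_enum (edge_corona G1 G2) vs"
    and "\<Gamma> = (\<lambda>z. coronal (A_alpha \<alpha> G2 vs2) (z - 2 * of_real \<alpha>))"
    and "\<not> is_pole \<Gamma> \<nu>"
    \<comment> \<open>the quotient on the right-hand side is defined\<close>
    and "1 + of_real \<beta> * \<Gamma> \<nu> \<noteq> 0"
  shows "char_fun (A_alpha \<alpha> (edge_corona G1 G2) vs) \<nu> =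
    char_fun (A_alpha \<alpha> G2 vs2) (\<nu> - 2 * of_real \<alpha>) ^ m1
    * char_fun (A_alpha \<alpha> G1 vs1)
        ((\<nu> - of_real \<alpha> * of_nat k1 * of_nat n2
            + of_real \<beta> * of_nat k1 * (2 * of_real \<alpha> - 1) * \<Gamma> \<nu>)
         / (1 + of_real \<beta> * \<Gamma> \<nu>))
    * (1 + of_real \<beta> * \<Gamma> \<nu>) ^ n1"
proof -
  interpret G1: pair_graph G1 by fact
  interpret G2: pair_graph G2 by fact
  note \<Gamma> = assms(15) and pole = assms(16) and nonzero = assms(17)
  show ?thesis
    using G1.char_fun_edge_corona_regular[OF G2.pair_fin_digraph assms(6,12-14)
        pole[unfolded \<Gamma>] nonzero[unfolded \<Gamma> assms(3)]]
    unfolding corona_argument_def \<Gamma> assms(3,7,8,11) .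
qed

end
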